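(* Let $(X,\wp)$ be a consistency space in which every element has a negation, and let $t,x,y,z\in X$. If $x\to t$ and $y\to t$, and $\{\bar{x},\bar{y}\}\sim\{\bar{z}\}$, then $z\to t$.
   Context: A consistency space $(X,\wp)$ consists of a nonempty set $X$ and a nonempty collection $\wp$ of subsets of $X$ such that (1) $X\notin\wp$, and (2) if $A\in\wp$ and $B\subseteq A$, then $B\in\wp$. For $A,B\subseteq X$, write $A\sim B$ if for every $C\subseteq X$, $A\cup C\in\wp$ if and only if $B\cup C\in\wp$. A negation of $x\in X$ is any element $\bar{x}\in X$ satisfying: (1) $\{x,\bar{x}\}\notin\wp$; (2) for all $z\in X$, if $\{x,z\}\notin\wp$ then $\{\bar{x},z\}\sim\{z\}$; (3) for all $z\in X$, if $\{\bar{x},z\}\notin\wp$ then $\{x,z\}\sim\{z\}$. For each $x\in X$, $\bar{x}$ denotes an (arbitrary but fixed) negation of $x$. For $x,y\in X$, write $x\to y$ if and only if $\{x,\bar{y}\}\notin\wp$. *)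

theory Defs
  imports Main
begin

locale consistency_space =
  fixes X :: "'a set" and P :: "'a set set"
  assumes carrier_nonempty: "X \<noteq> {}"
    and consistent_subsets: "P \<subseteq> Pow X"
    and consistent_nonempty: "P \<noteq> {}"
    and carrier_inconsistent: "X \<notin> P"
    and consistent_down_closed: "A \<in> P \<Longrightarrow> B \<subseteq> A \<Longrightarrow> B \<in> P"

(* A and B are intended to range over subsets of X. *)
definition cs_equiv :: "'a set \<Rightarrow> 'a set set \<Rightarrow> 'a set \<Rightarrow> 'a set \<Rightarrow> bool" where
  "cs_equiv X P A B \<longleftrightarrow> (\<forall>C. C \<subseteq> X \<longrightarrow> (A \<union> C \<in> P \<longleftrightarrow> B \<union> C \<in> P))"

definition is_negation :: "'a set \<Rightarrow> 'a set set \<Rightarrow> 'a \<Rightarrow> 'a \<Rightarrow> bool" where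
  "is_negation X P x x' \<longleftrightarrow>
     x' \<in> X \<and> {x, x'} \<notin> P \<and>
     (\<forall>z\<in>X. {x, z} \<notin> P \<longrightarrow> cs_equiv X P {x', z} {z}) \<and>
     (\<forall>z\<in>X. {x', z} \<notin> P \<longrightarrow> cs_equiv X P {x, z} {z})"

(* A negation need not be unique, so the arrow depends on the chosen negation function neg. *)
definition cs_arrow :: "'a set set \<Rightarrow> ('a \<Rightarrow> 'a) \<Rightarrow> 'a \<Rightarrow> 'a \<Rightarrow> bool" where
  "cs_arrow P neg x y \<longleftrightarrow> {x, neg y} \<notin> P"

end

theory Submission
  imports Defs
begin

text \<open>If \<open>{x, neg t}\<close> is inconsistent, the negation laws let \<open>neg x\<close> be adjoined freely to any
  consistent set containing \<open>neg t\<close>; likewise for \<open>y\<close>. So if \<open>{z, neg t}\<close> were consistent, it would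
  stay consistent after adjoining \<open>neg x\<close> and \<open>neg y\<close>. The equivalence then trades this
  pair for \<open>neg z\<close>, giving a consistent set that contains both \<open>z\<close> and \<open>neg z\<close>.\<close>

theorem proposition12:
  fixes X :: "'a set" and P :: "'a set set" and neg :: "'a \<Rightarrow> 'a" and t x y z :: 'a
  assumes "consistency_space X P"
    and "\<forall>u\<in>X. is_negation X P u (neg u)"
    and "t \<in> X" and "x \<in> X" and "y \<in> X" and "z \<in> X"
    and "cs_arrow P neg x t" and "cs_arrow P neg y t"
    and "cs_equiv X P {neg x, neg y} {neg z}"
  shows "cs_arrow P neg z t"
proof (rule ccontr)
  assume "\<not> cs_arrow P neg z t"
  then have cons: "{neg t} \<union> {z} \<in> P"
    by (simp add: cs_arrow_def insert_commute)
  have neg_in: "neg u \<in> X" if "u \<in> X" for u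
    using assms(2) that by (simp add: is_negation_def)
  have equivD: "A \<union> C \<in> P \<longleftrightarrow> B \<union> C \<in> P" if "cs_equiv X P A B" "C \<subseteq> X" for A B C
    using that by (simp add: cs_equiv_def)
  have absorb: "cs_equiv X P {neg u, neg t} {neg t}" if "u \<in> X" "cs_arrow P neg u t" for u
    using assms(2) that neg_in[OF \<open>t \<in> X\<close>] by (simp add: is_negation_def cs_arrow_def)
  have "{neg y, neg t} \<union> {z} \<in> P"
    using equivD[OF absorb[OF \<open>y \<in> X\<close> assms(8)], of "{z}"] cons \<open>z \<in> X\<close> by simp
  then have "{neg t} \<union> {neg y, z} \<in> P"
    by (simp add: insert_commute)
  then have "{neg x, neg t} \<union> {neg y, z} \<in> P"
    using equivD[OF absorb[OF \<open>x \<in> X\<close> assms(7)], of "{neg y, z}"] neg_in[OF \<open>y \<in> X\<close>] \<open>z \<in> X\<close>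
    by simp
  then have "{neg x, neg y} \<union> {neg t, z} \<in> P"
    by (simp add: insert_commute)
  then have "{neg z} \<union> {neg t, z} \<in> P"
    using equivD[OF assms(9), of "{neg t, z}"] neg_in[OF \<open>t \<in> X\<close>] \<open>z \<in> X\<close> by simp
  then have "{z, neg z} \<in> P"
    by (rule consistency_space.consistent_down_closed[OF assms(1)]) auto
  then show False
    using assms(2) \<open>z \<in> X\<close> by (simp add: is_negation_def)
qed

end
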